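(* Every graph with tree-independence number $k$ has o-mim-width at most $k$.
   Context: A tree decomposition of a graph $G$ is a pair $(T,\mathrm{bag})$ with $T$ a tree and $\mathrm{bag} : V(T) \to 2^{V(G)}$ such that every edge of $G$ has both endpoints in some bag and, for every vertex $v$, the nodes whose bags contain $v$ induce a non-empty connected subtree of $T$. For $X \subseteq V(G)$, $\alpha(X)$ is the maximum size of an independent set of $G$ contained in $X$. The tree-independence number of $G$ is the minimum, over tree decompositions $(T,\mathrm{bag})$ of $G$, of $\max_{t \in V(T)} \alpha(\mathrm{bag}(t))$. Branch decompositions: for a finite set $V$ and a symmetric function $f : 2^V \to \mathbb{Z}_{\ge 0}$ ($f(X) = f(V\setminus X)$), a branch decomposition of $f$ is a pair $(T,\delta)$ where $T$ is a tree whose internal nodes have degree $3$ and $\delta$ is a bijection from $V$ to the leaves of $T$; each edge $e$ of $T$ induces a bipartition $(A_e, V \setminus A_e)$ of $V$ via the leaves on either side; its width is $f(A_e)$; the width of the decomposition is the maximum edge width, and the $f$-width of $G$ (for $f$ on $V(G)$) is the minimum width of a branch decomposition of $f$. For $A \subseteq V(G)$, $\overline{A} = V(G)\setminus A$; $E(\overline{A})$ is the set of edges with both endpoints in $\overline{A}$. An $(A,\overline{A})$-matching is a matching each of whose edges has one endpoint in $A$ and one in $\overline{A}$; a matching $M$ in a graph $H$ is induced if $H$ restricted to the endpoints of $M$ has no edges besides $M$. $\mathrm{umim}(A)$ is the maximum size of an induced $(A,\overline{A})$-matching in $G - E(\overline{A})$, and $\mathrm{omim}(A) = \min(\mathrm{umim}(A),\mathrm{umim}(\overline{A}))$.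 The o-mim-width of $G$ is its $\mathrm{omim}$-width. *)

theory Defs
  imports Main "HOL-Library.Extended_Nat"
begin

section \<open>Finite simple graphs\<close>

record 'a sgraph =
  verts :: "'a set"
  edges :: "'a set set"

definition simple_graph :: "'a sgraph \<Rightarrow> bool" where
  "simple_graph G \<longleftrightarrow>
     finite (verts G) \<and> (\<forall>e\<in>edges G. e \<subseteq> verts G \<and> card e = 2)"

definition edges_within :: "'a sgraph \<Rightarrow> 'a set \<Rightarrow> 'a set set" where
  "edges_within G X = {e \<in> edges G. e \<subseteq> X}"

definition induced_subgraph :: "'a sgraph \<Rightarrow> 'a set \<Rightarrow> 'a sgraph" where
  "induced_subgraph G X = \<lparr>verts = X, edges = edges_within G X\<rparr>"

definition delete_edges :: "'a sgraph \<Rightarrow> 'a set set \<Rightarrow> 'a sgraph" where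
  "delete_edges G F = \<lparr>verts = verts G, edges = edges G - F\<rparr>"

definition degree :: "'a sgraph \<Rightarrow> 'a \<Rightarrow> nat" where
  "degree G v = card {e \<in> edges G. v \<in> e}"

definition reachable :: "'a sgraph \<Rightarrow> 'a \<Rightarrow> 'a \<Rightarrow> bool" where
  "reachable G u v \<longleftrightarrow> (u, v) \<in> {(x, y). {x, y} \<in> edges G}\<^sup>*"

definition connected_graph :: "'a sgraph \<Rightarrow> bool" where
  "connected_graph G \<longleftrightarrow>
     verts G \<noteq> {} \<and> (\<forall>u\<in>verts G. \<forall>v\<in>verts G. reachable G u v)"

definition cycle :: "'a sgraph \<Rightarrow> 'a list \<Rightarrow> bool" where
  "cycle G xs \<longleftrightarrow>
     length xs \<ge> 3 \<and> distinct xs \<and>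
     (\<forall>i<length xs. {xs ! i, xs ! (Suc i mod length xs)} \<in> edges G)"

definition tree :: "'a sgraph \<Rightarrow> bool" where
  "tree T \<longleftrightarrow> simple_graph T \<and> connected_graph T \<and> (\<nexists>xs. cycle T xs)"

definition independent :: "'a sgraph \<Rightarrow> 'a set \<Rightarrow> bool" where
  "independent G I \<longleftrightarrow>
     I \<subseteq> verts G \<and> (\<forall>u\<in>I. \<forall>v\<in>I. {u, v} \<notin> edges G)"

definition alpha :: "'a sgraph \<Rightarrow> 'a set \<Rightarrow> nat" where
  "alpha G X = Max {card I | I. I \<subseteq> X \<and> independent G I}"

section \<open>Tree decompositions and tree-independence number\<close>

text \<open>Decomposition trees have nodes in \<^typ>\<open>nat\<close>. Every finite tree is isomorphic to such
  a tree, so this does not restrict the decompositions up to isomorphism.\<close>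

definition tree_decomposition :: "'a sgraph \<Rightarrow> nat sgraph \<Rightarrow> (nat \<Rightarrow> 'a set) \<Rightarrow> bool" where
  "tree_decomposition G T bag \<longleftrightarrow>
     tree T \<and>
     (\<forall>t\<in>verts T. bag t \<subseteq> verts G) \<and>
     (\<forall>e\<in>edges G. \<exists>t\<in>verts T. e \<subseteq> bag t) \<and>
     (\<forall>v\<in>verts G. connected_graph (induced_subgraph T {t \<in> verts T. v \<in> bag t}))"

definition independence_width :: "'a sgraph \<Rightarrow> nat sgraph \<Rightarrow> (nat \<Rightarrow> 'a set) \<Rightarrow> nat" where
  "independence_width G T bag = Max ((\<lambda>t. alpha G (bag t)) ` verts T)"

text \<open>Minima over decompositions are taken in \<^typ>\<open>enat\<close>, where a nonempty infimum is attained
  and the infimum of the empty set is infinite. In particular a finite upper bound on such a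
  minimum always comes with an actual decomposition.\<close>

definition tree_independence_number :: "'a sgraph \<Rightarrow> enat" where
  "tree_independence_number G =
     Inf {enat (independence_width G T bag) | T bag. tree_decomposition G T bag}"

section \<open>Branch decompositions\<close>

text \<open>Degree \<open>0\<close> is admitted for leaves so that the one-node tree is a branch decomposition of
  a one-element set.\<close>

definition leaves :: "'a sgraph \<Rightarrow> 'a set" where
  "leaves T = {t \<in> verts T. degree T t \<le> 1}"

definition branch_decomposition :: "'a set \<Rightarrow> nat sgraph \<Rightarrow> ('a \<Rightarrow> nat) \<Rightarrow> bool" where
  "branch_decomposition V T \<delta> \<longleftrightarrow>
     tree T \<and> (\<forall>t\<in>verts T - leaves T. degree T t = 3) \<and> bij_betw \<delta> V (leaves T)"

text \<open>The vertices placed on the \<open>x\<close>-side of the tree edge \<open>{x, y}\<close>.\<close>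

definition edge_side :: "'a set \<Rightarrow> nat sgraph \<Rightarrow> ('a \<Rightarrow> nat) \<Rightarrow> nat \<Rightarrow> nat \<Rightarrow> 'a set" where
  "edge_side V T \<delta> x y = {v \<in> V. reachable (delete_edges T {{x, y}}) x (\<delta> v)}"

text \<open>Both sides of every edge are evaluated; for a symmetric \<open>f\<close> they have the same value.
  A decomposition tree without edges has width \<open>0\<close>.\<close>

definition branch_decomposition_width ::
    "'a set \<Rightarrow> ('a set \<Rightarrow> nat) \<Rightarrow> nat sgraph \<Rightarrow> ('a \<Rightarrow> nat) \<Rightarrow> nat" where
  "branch_decomposition_width V f T \<delta> =
     Max (insert 0 {f (edge_side V T \<delta> x y) | x y. {x, y} \<in> edges T})"

text \<open>Trees are nonempty, so the empty set has no branch decomposition; its width is \<open>0\<close> by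
  convention.\<close>

definition branch_width :: "'a set \<Rightarrow> ('a set \<Rightarrow> nat) \<Rightarrow> enat" where
  "branch_width V f =
     (if V = {} then 0
      else Inf {enat (branch_decomposition_width V f T \<delta>) | T \<delta>. branch_decomposition V T \<delta>})"

section \<open>o-mim-width\<close>

definition matching :: "'a sgraph \<Rightarrow> 'a set set \<Rightarrow> bool" where
  "matching H M \<longleftrightarrow> M \<subseteq> edges H \<and> (\<forall>e\<in>M. \<forall>e'\<in>M. e \<noteq> e' \<longrightarrow> e \<inter> e' = {})"

definition induced_matching :: "'a sgraph \<Rightarrow> 'a set set \<Rightarrow> bool" where
  "induced_matching H M \<longleftrightarrow> matching H M \<and> edges (induced_subgraph H (\<Union>M)) = M"

definition crossing :: "'a set \<Rightarrow> 'a set \<Rightarrow> 'a set set \<Rightarrow> bool" where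
  "crossing A B M \<longleftrightarrow> (\<forall>e\<in>M. \<exists>a\<in>A. \<exists>b\<in>B. e = {a, b})"

definition umim :: "'a sgraph \<Rightarrow> 'a set \<Rightarrow> nat" where
  "umim G A =
     (let B = verts G - A
      in Max {card M | M. crossing A B M \<and>
                          induced_matching (delete_edges G (edges_within G B)) M})"

definition omim :: "'a sgraph \<Rightarrow> 'a set \<Rightarrow> nat" where
  "omim G A = min (umim G A) (umim G (verts G - A))"

lemma omim_symmetric:
  assumes "A \<subseteq> verts G"
  shows "omim G (verts G - A) = omim G A"
  using assms by (simp add: omim_def double_diff min.commute)

definition omim_width :: "'a sgraph \<Rightarrow> enat" where
  "omim_width G = branch_width (verts G) (omim G)"

end

theory Submission
  imports Defs
begin

text \<open>Take a vertex \<open>w\<close> and root the decomposition tree at a node whose bag contains \<open>w\<close>. For a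
  node \<open>c\<close>, first merge the sets of vertices living strictly below its children, then add one by
  one the vertices whose topmost bag is the bag of \<open>c\<close>. If \<open>A\<close> is a set arising in this way,
  every edge leaving \<open>A\<close> has its outer endpoint in the bag of \<open>c\<close>; the outer endpoints of an
  induced matching counted by \<open>umim\<close> of the complement of \<open>A\<close> are thus an independent subset of
  that bag. Singletons have \<open>umim\<close> at most \<open>1\<close>. With \<open>w\<close> added last, the merging order is a
  branch decomposition whose cuts are exactly these sets.\<close>

section \<open>Reachability, paths and bridges\<close>

lemma reachable_refl: "reachable G u u"
  by (simp add: reachable_def)

lemma reachable_edge: "{u, v} \<in> edges G \<Longrightarrow> reachable G u v"
  by (auto simp: reachable_def)

lemma reachable_trans: "reachable G u v \<Longrightarrow> reachable G v w \<Longrightarrow> reachable G u w"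
  unfolding reachable_def by (rule rtrancl_trans)

lemma reachable_sym: "reachable G u v \<Longrightarrow> reachable G v u"
  unfolding reachable_def
  by (rule symD[OF sym_rtrancl]) (auto simp: sym_def insert_commute)

text \<open>The standard way below to confine a walk: every location argument in a tree exhibits a
  set that no edge leaves.\<close>

lemma reachable_closed:
  assumes "reachable G u v" "u \<in> C"
    and "\<And>x y. {x, y} \<in> edges G \<Longrightarrow> x \<in> C \<Longrightarrow> y \<in> C"
  shows "v \<in> C"
  using assms(1) unfolding reachable_def
  by (induction rule: rtrancl_induct) (use assms in auto)

lemma edges_delete_edges [simp]: "edges (delete_edges G F) = edges G - F"
  by (simp add: delete_edges_def)

lemma reachable_distinct_path:
  assumes "reachable G u v"
  shows "\<exists>xs. xs \<noteq> [] \<and> distinct xs \<and> hd xs = u \<and> last xs = v \<and>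
    successively (\<lambda>a b. {a, b} \<in> edges G) xs"
  using assms unfolding reachable_def
proof (induction rule: rtrancl_induct)
  case base
  show ?case by (intro exI[of _ "[u]"]) auto
next
  case (step y z)
  then obtain xs where xs: "xs \<noteq> []" "distinct xs" "hd xs = u" "last xs = y"
    "successively (\<lambda>a b. {a, b} \<in> edges G) xs" by blast
  show ?case
  proof (cases "z \<in> set xs")
    case True
    \<comment> \<open>The path already visits \<open>z\<close>, so it is cut at that visit to keep
      its vertices distinct.\<close>
    then obtain us vs where *: "xs = us @ z # vs" by (meson split_list)
    show ?thesis
      by (intro exI[of _ "us @ [z]"]) (use xs * in \<open>auto simp: successively_append_iff hd_append\<close>)
  next
    case False
    show ?thesis
      by (intro exI[of _ "xs @ [z]"]) (use xs step False in \<open>auto simp: successively_append_iff\<close>)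
  qed
qed

lemma simple_graph_edge:
  assumes "simple_graph G" "{x, y} \<in> edges G"
  shows "x \<noteq> y" "x \<in> verts G" "y \<in> verts G"
  using assms by (auto simp: simple_graph_def)

lemma tree_simple_graph: "tree T \<Longrightarrow> simple_graph T"
  by (simp add: tree_def)

text \<open>A path from \<open>x\<close> to \<open>y\<close> that avoids the edge
  \<open>{x, y}\<close> is closed by this edge to a cycle. It has at least three vertices, because
  the only two-vertex path would be the deleted edge.\<close>

lemma tree_bridge:
  assumes "tree T" "{x, y} \<in> edges T"
  shows "\<not> reachable (delete_edges T {{x, y}}) x y"
proof
  assume "reachable (delete_edges T {{x, y}}) x y"
  from reachable_distinct_path[OF this] obtain xs where xs: "xs \<noteq> []" "distinct xs"
    "hd xs = x" "last xs = y" "successively (\<lambda>a b. {a, b} \<in> edges T - {{x, y}}) xs"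
    by auto
  have ne: "x \<noteq> y" using simple_graph_edge tree_simple_graph assms by metis
  have len: "length xs \<ge> 3"
  proof (rule ccontr)
    assume "\<not> length xs \<ge> 3"
    then consider a where "xs = [a]" | a b where "xs = [a, b]"
      using xs(1) by (cases xs; cases "tl xs"; cases "tl (tl xs)") auto
    then show False using xs ne by cases auto
  qed
  have "{xs ! i, xs ! (Suc i mod length xs)} \<in> edges T" if "i < length xs" for i
  proof (cases "Suc i < length xs")
    case True
    then show ?thesis using xs(5) by (auto simp: successively_conv_nth)
  next
    case False
    then have "i = length xs - 1" using that by simp
    then have "xs ! i = y" "xs ! (Suc i mod length xs) = x"
      using xs len by (auto simp: last_conv_nth hd_conv_nth)
    then show ?thesis using assms by (simp add: insert_commute)
  qed
  then have "cycle T xs" using len xs by (simp add: cycle_def)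
  then show False using assms by (auto simp: tree_def)
qed

section \<open>Trees given by parent functions\<close>

text \<open>The height \<open>h\<close> grows towards the parent. Climbing therefore ends at
  \<open>p\<close>, which gives connectedness, and on a cycle a vertex of least height would have
  its parent as both of its neighbours.\<close>

lemma tree_of_parent_function:
  fixes h :: "'b \<Rightarrow> nat"
  assumes fin: "finite W" and p: "p \<in> W"
    and par: "\<And>x. x \<in> W - {p} \<Longrightarrow> par x \<in> W \<and> h x < h (par x)"
  shows "tree \<lparr>verts = W, edges = (\<lambda>x. {x, par x}) ` (W - {p})\<rparr>" (is "tree ?T")
proof -
  have up: "reachable ?T x p" if "x \<in> W" for x
    using that
  proof (induction "Max (h ` W) - h x" arbitrary: x rule: less_induct)
    case less
    show ?case
    proof (cases "x = p")
      case True
      then show ?thesis by (simp add: reachable_refl)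
    next
      case False
      then have 1: "par x \<in> W" "h x < h (par x)" using par less.prems by auto
      have "h (par x) \<le> Max (h ` W)" using fin 1 by simp
      then have "reachable ?T (par x) p" using less.hyps 1 by auto
      moreover have "reachable ?T x (par x)"
        using False less.prems by (intro reachable_edge) auto
      ultimately show ?thesis by (rule reachable_trans[rotated])
    qed
  qed
  have "\<not> cycle ?T xs" for xs
  proof
    assume c: "cycle ?T xs"
    let ?n = "length xs"
    have n: "?n \<ge> 3" and d: "distinct xs"
      and e: "\<And>i. i < ?n \<Longrightarrow> {xs ! i, xs ! (Suc i mod ?n)} \<in> (\<lambda>x. {x, par x}) ` (W - {p})"
      using c by (auto simp: cycle_def)
    have "0 < ?n" using n by linarith
    then have "\<exists>i. i < ?n \<and> (\<forall>j. j < ?n \<longrightarrow> h (xs ! i) \<le> h (xs ! j))"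
      by (rule ex_has_least_nat)
    then obtain i where i: "i < ?n" and min: "\<And>j. j < ?n \<Longrightarrow> h (xs ! i) \<le> h (xs ! j)"
      by blast
    \<comment> \<open>A neighbour of \<open>xs ! i\<close> on the cycle cannot be its child, since
      children are strictly lower.\<close>
    have nb: "xs ! j = par (xs ! i)" if j: "j < ?n"
      and ej: "{xs ! i, xs ! j} \<in> (\<lambda>x. {x, par x}) ` (W - {p})" for j
    proof -
      from ej obtain z where z: "z \<in> W - {p}" "{xs ! i, xs ! j} = {z, par z}" by auto
      then show ?thesis using par[OF z(1)] min[OF j] by (auto simp: doubleton_eq_iff)
    qed
    \<comment> \<open>\<open>j\<close> and \<open>l\<close> are the cyclic predecessor and successor
      of \<open>i\<close>; they differ because the cycle has at least three vertices.\<close>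
    define j where "j = (if i = 0 then ?n - 1 else i - 1)"
    have j: "j < ?n" "Suc j mod ?n = i" using i n by (auto simp: j_def)
    define l where "l = Suc i mod ?n"
    have l: "l < ?n" using i by (auto simp: l_def intro!: mod_less_divisor)
    have "l \<noteq> j" using i n by (auto simp: j_def l_def mod_Suc)
    moreover have "xs ! l = par (xs ! i)" using nb[OF l] e[OF i] by (simp add: l_def)
    moreover have "xs ! j = par (xs ! i)"
      using nb[OF j(1)] e[OF j(1)] by (simp add: j(2) insert_commute)
    ultimately show False using d j l by (metis nth_eq_iff_index_eq)
  qed
  moreover have "connected_graph ?T"
    using p by (auto simp: connected_graph_def intro: reachable_trans[OF up reachable_sym[OF up]])
  moreover have "simple_graph ?T"
  proof -
    have "x \<noteq> par x" "par x \<in> W" if "x \<in> W - {p}" for x using par[OF that] by auto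
    then show ?thesis using fin by (auto simp: simple_graph_def card_insert_if)
  qed
  ultimately show ?thesis by (auto simp: tree_def)
qed

text \<open>The height orients each edge, so an edge determines its lower end. The edges at
  \<open>y\<close> thus correspond to the children of \<open>y\<close> and, unless \<open>y\<close>
  is the root, to \<open>y\<close> itself.\<close>

lemma degree_parent_function:
  fixes h :: "'b \<Rightarrow> nat"
  assumes fin: "finite W"
    and par: "\<And>x. x \<in> W - {p} \<Longrightarrow> par x \<in> W \<and> h x < h (par x)"
    and y: "y \<in> W"
  shows "degree \<lparr>verts = W, edges = (\<lambda>x. {x, par x}) ` (W - {p})\<rparr> y =
    (if y = p then 0 else 1) + card {x \<in> W - {p}. par x = y}"
proof -
  let ?C = "{x \<in> W - {p}. par x = y}"
  have inj: "inj_on (\<lambda>x. {x, par x}) (W - {p})"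
  proof (rule inj_onI)
    fix x z assume *: "x \<in> W - {p}" "z \<in> W - {p}" "{x, par x} = {z, par z}"
    then show "x = z" using par[of x] par[of z] by (auto simp: doubleton_eq_iff)
  qed
  have "{e \<in> (\<lambda>x. {x, par x}) ` (W - {p}). y \<in> e} =
      (\<lambda>x. {x, par x}) ` (({y} - {p}) \<union> ?C)"
    using y by auto
  moreover have "inj_on (\<lambda>x. {x, par x}) (({y} - {p}) \<union> ?C)"
    by (rule inj_on_subset[OF inj]) (use y in auto)
  moreover have "y \<noteq> par y" if "y \<noteq> p" using par[of y] y that by auto
  ultimately have "degree \<lparr>verts = W, edges = (\<lambda>x. {x, par x}) ` (W - {p})\<rparr> y =
      card (({y} - {p}) \<union> ?C)"
    by (simp add: degree_def card_image)
  also have "\<dots> = card ({y} - {p}) + card ?C"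
    using fin par[of y] y by (intro card_Un_disjoint) auto
  finally show ?thesis by (simp add: card_Diff_singleton_if)
qed

section \<open>Branches of a tree at an edge\<close>

text \<open>Seen from a root on the side of \<open>t\<close>, this is the subtree hanging at
  \<open>c\<close>. Indexing subtrees by directed edges avoids fixing a root.\<close>

definition branch :: "'b sgraph \<Rightarrow> 'b \<Rightarrow> 'b \<Rightarrow> 'b set" where
  "branch T c t = {z. reachable (delete_edges T {{c, t}}) c z}"

lemma branch_self: "c \<in> branch T c t"
  by (simp add: branch_def reachable_refl)

lemma branch_not_other:
  assumes "tree T" "{c, t} \<in> edges T"
  shows "t \<notin> branch T c t"
  using tree_bridge[OF assms] by (simp add: branch_def)

text \<open>As \<open>t\<close> is outside the branch, the deleted edge could only be crossed from
  \<open>c\<close> to \<open>t\<close>, which the last assumption excludes.\<close>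

lemma branch_closed:
  assumes "tree T" "{c, t} \<in> edges T" "x \<in> branch T c t" "{x, y} \<in> edges T" "x \<noteq> c \<or> y \<noteq> t"
  shows "y \<in> branch T c t"
proof -
  have "x \<noteq> t" using branch_not_other assms by metis
  then have "{x, y} \<noteq> {c, t}" using assms by (auto simp: doubleton_eq_iff)
  then have "reachable (delete_edges T {{c, t}}) x y"
    using assms by (intro reachable_edge) auto
  then show ?thesis using assms(3) reachable_trans by (fastforce simp: branch_def)
qed

lemma branch_subset_verts:
  assumes "tree T" "{c, t} \<in> edges T"
  shows "branch T c t \<subseteq> verts T"
proof
  fix z assume "z \<in> branch T c t"
  then have "reachable (delete_edges T {{c, t}}) c z" by (simp add: branch_def)
  then show "z \<in> verts T"
    by (rule reachable_closed) (use simple_graph_edge[OF tree_simple_graph[OF assms(1)]] assms(2) in auto)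
qed

text \<open>Together with \<open>c\<close>, the branches at the neighbours of \<open>c\<close> form
  a set closed under edges: a branch can only be left towards \<open>c\<close>.\<close>

lemma branch_cover:
  assumes "tree T" "c \<in> verts T" "z \<in> verts T" "z \<noteq> c"
  shows "\<exists>q. {q, c} \<in> edges T \<and> z \<in> branch T q c"
proof -
  have "reachable T c z" using assms by (auto simp: tree_def connected_graph_def)
  then have "z \<in> insert c (\<Union>q\<in>{q. {q, c} \<in> edges T}. branch T q c)"
  proof (rule reachable_closed)
    fix x y assume e: "{x, y} \<in> edges T"
      and x: "x \<in> insert c (\<Union>q\<in>{q. {q, c} \<in> edges T}. branch T q c)"
    show "y \<in> insert c (\<Union>q\<in>{q. {q, c} \<in> edges T}. branch T q c)"
    proof (cases "x = c")
      case True
      then show ?thesis using e branch_self by (fastforce simp: insert_commute)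
    next
      case False
      then show ?thesis using e x branch_closed[OF assms(1)] by auto
    qed
  qed auto
  then show ?thesis using assms by auto
qed

lemma branch_disjoint_opposite:
  assumes "tree T" "{c, t} \<in> edges T"
  shows "branch T c t \<inter> branch T t c = {}"
proof (rule ccontr)
  assume "\<not> ?thesis"
  then obtain z where "reachable (delete_edges T {{c, t}}) c z" "reachable (delete_edges T {{c, t}}) t z"
    by (auto simp: branch_def insert_commute)
  then show False using tree_bridge[OF assms] reachable_sym reachable_trans by metis
qed

text \<open>A walk inside the branch of \<open>q\<close> never meets \<open>c\<close>, so it cannot
  use the edge from \<open>c\<close> to \<open>t\<close>; hence the intersection of both branches
  serves as the invariant. Strictness comes from \<open>c\<close> and drives the later induction
  over subtrees.\<close>

lemma branch_psubset:
  assumes "tree T" "{q, c} \<in> edges T" "{c, t} \<in> edges T" "q \<noteq> t"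
  shows "branch T q c \<subset> branch T c t"
proof -
  have "z \<in> branch T c t" if "z \<in> branch T q c" for z
  proof -
    have "z \<in> branch T q c \<inter> branch T c t"
    proof (rule reachable_closed)
      show "reachable (delete_edges T {{q, c}}) q z" using that by (simp add: branch_def)
      show "q \<in> branch T q c \<inter> branch T c t"
        using branch_self branch_closed[OF assms(1,3) branch_self] assms
        by (metis IntI insert_commute)
    next
      fix x y assume e: "{x, y} \<in> edges (delete_edges T {{q, c}})"
        and x: "x \<in> branch T q c \<inter> branch T c t"
      then have "x \<noteq> c" using branch_not_other[OF assms(1,2)] by auto
      then show "y \<in> branch T q c \<inter> branch T c t"
        using e x branch_closed[OF assms(1,2)] branch_closed[OF assms(1,3)] by auto
    qed
    then show ?thesis by simp
  qed
  then show ?thesis using branch_self[of c T t] branch_not_other[OF assms(1,2)] by blast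
qed

text \<open>The branch of \<open>q\<close> lies in that of \<open>c\<close> away from
  \<open>q'\<close>, which is the opposite side of the edge \<open>{q', c}\<close>.\<close>

lemma branch_disjoint_sibling:
  assumes "tree T" "{q, c} \<in> edges T" "{q', c} \<in> edges T" "q \<noteq> q'"
  shows "branch T q c \<inter> branch T q' c = {}"
  using branch_psubset[of T q c q'] branch_disjoint_opposite[of T q' c] assms
  by (auto simp: insert_commute)

text \<open>The only exit from the branch leads through \<open>c\<close>, which \<open>N\<close>
  avoids. It is applied to the set of nodes whose bags contain a given vertex.\<close>

lemma connected_subset_branch:
  assumes "tree T" "{q, c} \<in> edges T" "connected_graph (induced_subgraph T N)"
    and "c \<notin> N" "N \<inter> branch T q c \<noteq> {}"
  shows "N \<subseteq> branch T q c"
proof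
  fix z assume z: "z \<in> N"
  obtain x where x: "x \<in> N" "x \<in> branch T q c" using assms by auto
  then have "reachable (induced_subgraph T N) x z"
    using z assms(3) by (auto simp: connected_graph_def induced_subgraph_def)
  then show "z \<in> branch T q c"
    by (rule reachable_closed)
      (use x branch_closed[OF assms(1,2)] assms(4) in
        \<open>auto simp: induced_subgraph_def edges_within_def\<close>)
qed

section \<open>Binary laminar families\<close>

text \<open>A rooted binary tree with leaf set \<open>X\<close>, each node being represented by the
  set of leaves below it. The clause on proper subsets of \<open>Y\<close> makes \<open>Y1\<close>
  and \<open>Y2\<close> exactly the two children.\<close>

definition binary_family :: "('a set \<Rightarrow> bool) \<Rightarrow> 'a set \<Rightarrow> 'a set set \<Rightarrow> bool" where
  "binary_family P X F \<longleftrightarrow> finite F \<and> X \<in> F \<and>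
     (\<forall>Y\<in>F. Y \<subseteq> X \<and> Y \<noteq> {} \<and> P Y) \<and>
     (\<forall>Y\<in>F. \<forall>Z\<in>F. Y \<subseteq> Z \<or> Z \<subseteq> Y \<or> Y \<inter> Z = {}) \<and>
     (\<forall>Y\<in>F. (\<exists>v. Y = {v}) \<or>
        (\<exists>Y1\<in>F. \<exists>Y2\<in>F. Y = Y1 \<union> Y2 \<and> Y1 \<inter> Y2 = {} \<and>
           (\<forall>Z\<in>F. Z \<subset> Y \<longrightarrow> Z \<subseteq> Y1 \<or> Z \<subseteq> Y2))) \<and>
     (\<forall>v\<in>X. {v} \<in> F)"

lemma binary_family_singleton: "P {v} \<Longrightarrow> binary_family P {v} {{v}}"
  by (auto simp: binary_family_def)

text \<open>Two trees are joined under a new root. Members are nonempty and \<open>X\<close>,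
  \<open>Y\<close> disjoint, so the proper subsets of an old member come from its own family and the
  old splits remain valid.\<close>

lemma binary_family_Un:
  assumes F: "binary_family P X F" and H: "binary_family P Y H"
    and disj: "X \<inter> Y = {}" and P: "P (X \<union> Y)"
  shows "binary_family P (X \<union> Y) (insert (X \<union> Y) (F \<union> H))"
proof -
  let ?K = "insert (X \<union> Y) (F \<union> H)"
  have XF: "X \<in> F" and F1: "\<And>Z. Z \<in> F \<Longrightarrow> Z \<subseteq> X \<and> Z \<noteq> {} \<and> P Z"
    and F2: "\<And>Z Z'. Z \<in> F \<Longrightarrow> Z' \<in> F \<Longrightarrow> Z \<subseteq> Z' \<or> Z' \<subseteq> Z \<or> Z \<inter> Z' = {}"
    and F3: "\<And>Z. Z \<in> F \<Longrightarrow> (\<exists>v. Z = {v}) \<or> (\<exists>Y1\<in>F. \<exists>Y2\<in>F. Z = Y1 \<union> Y2 \<and> Y1 \<inter> Y2 = {} \<and>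
           (\<forall>Z'\<in>F. Z' \<subset> Z \<longrightarrow> Z' \<subseteq> Y1 \<or> Z' \<subseteq> Y2))"
    using F by (simp_all add: binary_family_def)
  have YH: "Y \<in> H" and H1: "\<And>Z. Z \<in> H \<Longrightarrow> Z \<subseteq> Y \<and> Z \<noteq> {} \<and> P Z"
    and H2: "\<And>Z Z'. Z \<in> H \<Longrightarrow> Z' \<in> H \<Longrightarrow> Z \<subseteq> Z' \<or> Z' \<subseteq> Z \<or> Z \<inter> Z' = {}"
    and H3: "\<And>Z. Z \<in> H \<Longrightarrow> (\<exists>v. Z = {v}) \<or> (\<exists>Y1\<in>H. \<exists>Y2\<in>H. Z = Y1 \<union> Y2 \<and> Y1 \<inter> Y2 = {} \<and>
           (\<forall>Z'\<in>H. Z' \<subset> Z \<longrightarrow> Z' \<subseteq> Y1 \<or> Z' \<subseteq> Y2))"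
    using H by (simp_all add: binary_family_def)
  have split: "(\<exists>v. Z = {v}) \<or> (\<exists>Y1\<in>?K. \<exists>Y2\<in>?K. Z = Y1 \<union> Y2 \<and> Y1 \<inter> Y2 = {} \<and>
           (\<forall>Z'\<in>?K. Z' \<subset> Z \<longrightarrow> Z' \<subseteq> Y1 \<or> Z' \<subseteq> Y2))" if "Z \<in> ?K" for Z
  proof -
    consider "Z = X \<union> Y" | "Z \<in> F" | "Z \<in> H" using \<open>Z \<in> ?K\<close> by auto
    then show ?thesis
    proof cases
      case 1
      have "Z' \<subseteq> X \<or> Z' \<subseteq> Y" if "Z' \<in> ?K" "Z' \<subset> Z" for Z'
        using that F1 H1 1 by auto
      then show ?thesis using XF YH disj 1 by blast
    next
      case 2
      have sub: "Z' \<in> F" if "Z' \<in> ?K" "Z' \<subset> Z" for Z'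
        using that F1[OF 2] H1[of Z'] disj by blast
      from F3[OF 2] show ?thesis
      proof
        assume "\<exists>Y1\<in>F. \<exists>Y2\<in>F. Z = Y1 \<union> Y2 \<and> Y1 \<inter> Y2 = {} \<and>
           (\<forall>Z'\<in>F. Z' \<subset> Z \<longrightarrow> Z' \<subseteq> Y1 \<or> Z' \<subseteq> Y2)"
        then show ?thesis using sub by (metis UnI1 insertCI)
      qed simp
    next
      case 3
      have sub: "Z' \<in> H" if "Z' \<in> ?K" "Z' \<subset> Z" for Z'
        using that H1[OF 3] F1[of Z'] disj by blast
      from H3[OF 3] show ?thesis
      proof
        assume "\<exists>Y1\<in>H. \<exists>Y2\<in>H. Z = Y1 \<union> Y2 \<and> Y1 \<inter> Y2 = {} \<and>
           (\<forall>Z'\<in>H. Z' \<subset> Z \<longrightarrow> Z' \<subseteq> Y1 \<or> Z' \<subseteq> Y2)"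
        then show ?thesis using sub by (metis UnI2 insertCI)
      qed simp
    qed
  qed
  have lam: "Z \<subseteq> Z' \<or> Z' \<subseteq> Z \<or> Z \<inter> Z' = {}" if "Z \<in> ?K" "Z' \<in> ?K" for Z Z'
  proof -
    have "Z \<inter> Z' = {}" if "Z \<in> F" "Z' \<in> H" for Z Z'
      using F1[OF that(1)] H1[OF that(2)] disj by blast
    moreover have "Z \<subseteq> X \<union> Y" if "Z \<in> ?K" for Z
      using F1[of Z] H1[of Z] that by blast
    ultimately show ?thesis using that F2 H2 by (metis UnE insertE inf_commute)
  qed
  have fin: "finite ?K" and sing: "\<forall>v\<in>X \<union> Y. {v} \<in> ?K"
    using F H by (auto simp: binary_family_def)
  have mem: "Z \<subseteq> X \<union> Y \<and> Z \<noteq> {} \<and> P Z" if "Z \<in> ?K" for Z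
    using F1[of Z] H1[of Z] F1[OF XF] that P by blast
  have "\<forall>Z\<in>?K. Z \<subseteq> X \<union> Y \<and> Z \<noteq> {} \<and> P Z"
    "\<forall>Z\<in>?K. \<forall>Z'\<in>?K. Z \<subseteq> Z' \<or> Z' \<subseteq> Z \<or> Z \<inter> Z' = {}"
    "\<forall>Z\<in>?K. (\<exists>v. Z = {v}) \<or> (\<exists>Y1\<in>?K. \<exists>Y2\<in>?K. Z = Y1 \<union> Y2 \<and> Y1 \<inter> Y2 = {} \<and>
       (\<forall>Z'\<in>?K. Z' \<subset> Z \<longrightarrow> Z' \<subseteq> Y1 \<or> Z' \<subseteq> Y2))"
    by (rule ballI, erule mem, intro ballI, erule (1) lam, rule ballI, erule split)
  with fin sing show ?thesis unfolding binary_family_def by (intro conjI insertI1)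
qed

definition hierarchical :: "('a set \<Rightarrow> bool) \<Rightarrow> 'a set \<Rightarrow> bool" where
  "hierarchical P X \<longleftrightarrow> X = {} \<or> (\<exists>F. binary_family P X F)"

lemma hierarchical_empty: "hierarchical P {}"
  by (simp add: hierarchical_def)

lemma hierarchical_singleton: "P {v} \<Longrightarrow> hierarchical P {v}"
  unfolding hierarchical_def by (blast intro: binary_family_singleton)

lemma hierarchical_Un:
  assumes "hierarchical P X" "hierarchical P Y" "X \<inter> Y = {}" "P (X \<union> Y)"
  shows "hierarchical P (X \<union> Y)"
  using assms binary_family_Un[of P X _ Y] unfolding hierarchical_def by fastforce

text \<open>The sets are merged one at a time. The partial unions become nodes of the family, so
  \<open>P\<close> is demanded of all of them.\<close>

lemma hierarchical_UN:
  assumes "finite I" "\<And>i. i \<in> I \<Longrightarrow> hierarchical P (X i)"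
    and "\<And>i j. i \<in> I \<Longrightarrow> j \<in> I \<Longrightarrow> i \<noteq> j \<Longrightarrow> X i \<inter> X j = {}"
    and "\<And>J. J \<subseteq> I \<Longrightarrow> P (\<Union>i\<in>J. X i)"
  shows "hierarchical P (\<Union>i\<in>I. X i)"
  using assms
proof (induction I)
  case empty
  then show ?case by (simp add: hierarchical_empty)
next
  case (insert i I)
  have "hierarchical P (\<Union>i\<in>I. X i)" using insert by (intro insert.IH) blast+
  then have "hierarchical P (X i \<union> (\<Union>i\<in>I. X i))"
  proof (intro hierarchical_Un)
    show "X i \<inter> (\<Union>i\<in>I. X i) = {}" using insert.prems(2)[of i] insert.hyps by blast
    show "P (X i \<union> (\<Union>i\<in>I. X i))" using insert.prems(3)[of "insert i I"] by simp
  qed (use insert.prems(1) in auto)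
  then show ?case by simp
qed


section \<open>Merging vertices along a tree decomposition\<close>

definition bag_nodes :: "nat sgraph \<Rightarrow> (nat \<Rightarrow> 'a set) \<Rightarrow> 'a \<Rightarrow> nat set" where
  "bag_nodes T bag v = {t \<in> verts T. v \<in> bag t}"

text \<open>For a tree edge \<open>{q, c}\<close>, these are the vertices living strictly below
  \<open>c\<close> on the side of its child \<open>q\<close>; they do not occur in
  \<open>bag c\<close>.\<close>

definition below :: "'a sgraph \<Rightarrow> nat sgraph \<Rightarrow> (nat \<Rightarrow> 'a set) \<Rightarrow> nat \<Rightarrow> nat \<Rightarrow> 'a set" where
  "below G T bag q c = {v \<in> verts G. bag_nodes T bag v \<subseteq> branch T q c}"

lemma tree_decomposition_tree: "tree_decomposition G T bag \<Longrightarrow> tree T"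
  by (simp add: tree_decomposition_def)

lemma bag_nodes_nonempty:
  assumes "tree_decomposition G T bag" "v \<in> verts G"
  shows "bag_nodes T bag v \<noteq> {}"
  using assms
  by (auto simp: tree_decomposition_def bag_nodes_def connected_graph_def induced_subgraph_def)

lemma bag_nodes_connected:
  assumes "tree_decomposition G T bag" "v \<in> verts G"
  shows "connected_graph (induced_subgraph T (bag_nodes T bag v))"
  using assms by (auto simp: tree_decomposition_def bag_nodes_def)

lemma bag_nodes_edge:
  assumes "tree_decomposition G T bag" "{a, b} \<in> edges G"
  shows "bag_nodes T bag a \<inter> bag_nodes T bag b \<noteq> {}"
  using assms by (fastforce simp: tree_decomposition_def bag_nodes_def)

text \<open>The merging at one node, shared by inner nodes and the root. \<open>Q\<close> is the set
  of children of \<open>c\<close>, \<open>S\<close> the set of vertices to be added at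
  \<open>c\<close>; by \<open>sep\<close> these have no bags towards a neighbour outside
  \<open>Q\<close>. \<open>good\<close> is the only access to \<open>P\<close> beyond singletons, so
  each intermediate set must have all its outer neighbours in \<open>bag c\<close>.\<close>

lemma hierarchical_at_node:
  assumes G: "simple_graph G" and td: "tree_decomposition G T bag" and c: "c \<in> verts T"
    and Q: "Q \<subseteq> {q. {q, c} \<in> edges T}"
    and hQ: "\<And>q. q \<in> Q \<Longrightarrow> hierarchical P (below G T bag q c)"
    and S: "S \<subseteq> bag c"
    and sep: "\<And>a q. a \<in> S \<Longrightarrow> {q, c} \<in> edges T \<Longrightarrow> q \<notin> Q \<Longrightarrow> bag_nodes T bag a \<inter> branch T q c = {}"
    and single: "\<And>v. P {v}"
    and good: "\<And>A. A \<subseteq> verts G \<Longrightarrow>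
      (\<And>a b. {a, b} \<in> edges G \<Longrightarrow> a \<in> A \<Longrightarrow> b \<notin> A \<Longrightarrow> b \<in> bag c) \<Longrightarrow> P A"
  shows "hierarchical P ((\<Union>q\<in>Q. below G T bag q c) \<union> S)"
proof -
  note T = tree_decomposition_tree[OF td]
  note simT = tree_simple_graph[OF T]
  have bagV: "bag c \<subseteq> verts G" using td c by (auto simp: tree_decomposition_def)
  have finG: "finite (verts G)" using G by (simp add: simple_graph_def)
  have fin: "finite Q"
    using Q simple_graph_edge(2)[OF simT] simT
    by (auto simp: simple_graph_def intro: finite_subset[of Q "verts T"])
  let ?W = "\<lambda>J. \<Union>q\<in>J. below G T bag q c"
  have bag_c: "c \<in> bag_nodes T bag b \<longleftrightarrow> b \<in> bag c" for b using c by (simp add: bag_nodes_def)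
  \<comment> \<open>A vertex missing from \<open>bag c\<close> has all its bags in one branch, so a
    single node \<open>x\<close> locates it.\<close>
  have stay: "b \<in> below G T bag q c" if "b \<in> verts G" "b \<notin> bag c" "{q, c} \<in> edges T"
    "x \<in> bag_nodes T bag b" "x \<in> branch T q c" for b q x
    using connected_subset_branch[OF T \<open>{q, c} \<in> edges T\<close> bag_nodes_connected[OF td \<open>b \<in> verts G\<close>]]
      that bag_c by (auto simp: below_def)
  have edge_below: "b \<in> below G T bag q c" if e: "{a, b} \<in> edges G" and q: "q \<in> Q"
    and a: "a \<in> below G T bag q c" and b: "b \<notin> bag c" for a b q
  proof -
    from bag_nodes_edge[OF td e] obtain x where "x \<in> bag_nodes T bag a" "x \<in> bag_nodes T bag b"
      by blast
    then show ?thesis using a b q Q simple_graph_edge(3)[OF G e]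
      by (intro stay[of b q x]) (auto simp: below_def)
  qed
  \<comment> \<open>An edge starting below \<open>q\<close> either stays below \<open>q\<close> or
    ends in \<open>bag c\<close>, so partial merges are good as well.\<close>
  have PW: "P (?W J)" if "J \<subseteq> Q" for J
  proof (rule good)
    show "?W J \<subseteq> verts G" by (auto simp: below_def)
    show "b \<in> bag c" if "{a, b} \<in> edges G" "a \<in> ?W J" "b \<notin> ?W J" for a b
      using that edge_below[OF that(1)] \<open>J \<subseteq> Q\<close> by blast
  qed
  have "below G T bag q c \<inter> below G T bag q' c = {}" if "q \<in> Q" "q' \<in> Q" "q \<noteq> q'" for q q'
  proof -
    have "branch T q c \<inter> branch T q' c = {}" using that Q
      by (intro branch_disjoint_sibling[OF T]) auto
    then show ?thesis using bag_nodes_nonempty[OF td] unfolding below_def by blast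
  qed
  then have hW: "hierarchical P (?W Q)" using fin hQ PW by (intro hierarchical_UN) auto
  have disj: "?W Q \<inter> bag c = {}"
    using Q branch_not_other[OF T] bag_c unfolding below_def by blast
  \<comment> \<open>Otherwise a common bag of \<open>a\<close> and \<open>b\<close> would lie in a
    branch at \<open>c\<close> that contains all bags of \<open>b\<close>. That branch is not in
    \<open>Q\<close>, and \<open>sep\<close> keeps \<open>a\<close> out of it.\<close>
  have edge_own: "b \<in> bag c" if e: "{a, b} \<in> edges G" and a: "a \<in> S" and b: "b \<notin> ?W Q" for a b
  proof (rule ccontr)
    assume nb: "b \<notin> bag c"
    from bag_nodes_edge[OF td e] obtain x where x: "x \<in> bag_nodes T bag a" "x \<in> bag_nodes T bag b"
      by blast
    then have "x \<in> verts T" "x \<noteq> c" using nb bag_c by (auto simp: bag_nodes_def)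
    from branch_cover[OF T c this] obtain q where q: "{q, c} \<in> edges T" "x \<in> branch T q c" by blast
    then have "b \<in> below G T bag q c"
      using stay[OF simple_graph_edge(3)[OF G e] nb q(1) x(2) q(2)] by simp
    then have "q \<notin> Q" using b by blast
    then show False using sep[OF a q(1)] x q by blast
  qed
  have "hierarchical P (?W Q \<union> R)" if "finite R" "R \<subseteq> S" for R
    using that
  proof (induction R)
    case empty
    then show ?case using hW by simp
  next
    case (insert s R)
    have "P (?W Q \<union> R \<union> {s})"
    proof (rule good)
      show "?W Q \<union> R \<union> {s} \<subseteq> verts G" using insert.prems S bagV by (auto simp: below_def)
      show "b \<in> bag c" if "{a, b} \<in> edges G" "a \<in> ?W Q \<union> R \<union> {s}" "b \<notin> ?W Q \<union> R \<union> {s}" for a b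
        using that edge_below[OF that(1)] edge_own[OF that(1)] insert.prems by blast
    qed
    then have "hierarchical P (?W Q \<union> R \<union> {s})"
      using insert S disj
      by (intro hierarchical_Un[where Y = "{s}"] hierarchical_singleton single) auto
    then show ?case by simp
  qed
  then show ?thesis using finite_subset[OF S] finite_subset[OF bagV finG] by blast
qed

text \<open>The nodes of \<open>v\<close> form a connected set avoiding \<open>c\<close>, hence lie
  in a single branch at \<open>c\<close>.\<close>

lemma below_cover:
  assumes td: "tree_decomposition G T bag" and c: "c \<in> verts T"
    and v: "v \<in> verts G" "v \<notin> bag c"
  shows "\<exists>q x. {q, c} \<in> edges T \<and> v \<in> below G T bag q c \<and> x \<in> bag_nodes T bag v \<and> x \<in> branch T q c"
proof -
  note T = tree_decomposition_tree[OF td]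
  obtain x where x: "x \<in> bag_nodes T bag v" using bag_nodes_nonempty[OF td v(1)] by blast
  then have "x \<in> verts T" "x \<noteq> c" using v by (auto simp: bag_nodes_def)
  from branch_cover[OF T c this] obtain q where q: "{q, c} \<in> edges T" "x \<in> branch T q c" by blast
  have "bag_nodes T bag v \<subseteq> branch T q c"
    using connected_subset_branch[OF T q(1) bag_nodes_connected[OF td v(1)]] q x v
    by (auto simp: bag_nodes_def)
  then show ?thesis using q x v by (auto simp: below_def)
qed

text \<open>Induction on the size of the subtree: the branches at the children of \<open>c\<close>
  are strictly smaller by \<open>branch_psubset\<close>.\<close>

lemma hierarchical_below:
  assumes G: "simple_graph G" and td: "tree_decomposition G T bag"
    and single: "\<And>v. P {v}"
    and good: "\<And>A c. c \<in> verts T \<Longrightarrow> A \<subseteq> verts G \<Longrightarrow>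
      (\<And>a b. {a, b} \<in> edges G \<Longrightarrow> a \<in> A \<Longrightarrow> b \<notin> A \<Longrightarrow> b \<in> bag c) \<Longrightarrow> P A"
    and ct: "{c, t} \<in> edges T"
  shows "hierarchical P (below G T bag c t)"
  using ct
proof (induction "card (branch T c t)" arbitrary: c t rule: less_induct)
  case less
  note T = tree_decomposition_tree[OF td]
  note simT = tree_simple_graph[OF T]
  note ct = less.prems
  have c: "c \<in> verts T" using simple_graph_edge[OF simT ct] by simp
  let ?Q = "{q. {q, c} \<in> edges T \<and> q \<noteq> t}"
  \<comment> \<open>With \<open>t\<close> as the parent of \<open>c\<close>, these are the vertices
    whose topmost bag is that of \<open>c\<close>.\<close>
  let ?S = "below G T bag c t \<inter> bag c"
  have fin: "finite (branch T c t)"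
    using branch_subset_verts[OF T ct] simT by (auto simp: simple_graph_def intro: finite_subset)
  have sub: "branch T q c \<subset> branch T c t" if "q \<in> ?Q" for q
    using that branch_psubset[OF T _ ct] by auto
  have "hierarchical P ((\<Union>q\<in>?Q. below G T bag q c) \<union> ?S)"
  proof (rule hierarchical_at_node[OF G td c])
    show "hierarchical P (below G T bag q c)" if "q \<in> ?Q" for q
      using that sub[OF that] fin by (intro less.hyps psubset_card_mono) auto
    show "bag_nodes T bag a \<inter> branch T q c = {}"
      if "a \<in> ?S" "{q, c} \<in> edges T" "q \<notin> ?Q" for a q
      using that branch_disjoint_opposite[OF T ct] by (auto simp: below_def)
  qed (use single good[OF c] in auto)
  also have "(\<Union>q\<in>?Q. below G T bag q c) \<union> ?S = below G T bag c t"
  proof (intro equalityI subsetI)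
    fix v assume "v \<in> (\<Union>q\<in>?Q. below G T bag q c) \<union> ?S"
    then show "v \<in> below G T bag c t" using sub by (auto simp: below_def)
  next
    fix v assume v: "v \<in> below G T bag c t"
    show "v \<in> (\<Union>q\<in>?Q. below G T bag q c) \<union> ?S"
    proof (cases "v \<in> bag c")
      case False
      then obtain q x where q: "{q, c} \<in> edges T" "v \<in> below G T bag q c"
          "x \<in> bag_nodes T bag v" "x \<in> branch T q c"
        using below_cover[OF td c, of v] v by (auto simp: below_def)
      then have "q \<noteq> t" using branch_disjoint_opposite[OF T ct] v by (auto simp: below_def)
      then show ?thesis using q by auto
    qed (use v in auto)
  qed
  finally show ?case .
qed

text \<open>The merging at the root \<open>r\<close>, where every neighbour is a child. The vertex
  \<open>w\<close> is held back, to become the leaf above the family.\<close>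

lemma hierarchical_vertices_minus:
  assumes G: "simple_graph G" and td: "tree_decomposition G T bag"
    and single: "\<And>v. P {v}"
    and good: "\<And>A c. c \<in> verts T \<Longrightarrow> A \<subseteq> verts G \<Longrightarrow>
      (\<And>a b. {a, b} \<in> edges G \<Longrightarrow> a \<in> A \<Longrightarrow> b \<notin> A \<Longrightarrow> b \<in> bag c) \<Longrightarrow> P A"
    and r: "r \<in> verts T" "w \<in> bag r"
  shows "hierarchical P (verts G - {w})"
proof -
  note T = tree_decomposition_tree[OF td]
  let ?Q = "{q. {q, r} \<in> edges T}"
  have "hierarchical P ((\<Union>q\<in>?Q. below G T bag q r) \<union> (bag r - {w}))"
    by (rule hierarchical_at_node[OF G td r(1)])
      (use single good[OF r(1)] hierarchical_below[OF G td, of P] good in auto)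
  also have "(\<Union>q\<in>?Q. below G T bag q r) \<union> (bag r - {w}) = verts G - {w}"
  proof (intro equalityI subsetI)
    fix v assume v: "v \<in> (\<Union>q\<in>?Q. below G T bag q r) \<union> (bag r - {w})"
    have "w \<notin> below G T bag q r" if "{q, r} \<in> edges T" for q
      using branch_not_other[OF T that] r by (auto simp: below_def bag_nodes_def)
    then show "v \<in> verts G - {w}" using v td r by (auto simp: below_def tree_decomposition_def)
  next
    fix v assume "v \<in> verts G - {w}"
    then show "v \<in> (\<Union>q\<in>?Q. below G T bag q r) \<union> (bag r - {w})"
      using below_cover[OF td r(1), of v] by auto
  qed
  finally show ?thesis .
qed

section \<open>Bounds on \<open>umim\<close>\<close>

lemma umim_le:
  assumes G: "simple_graph G"
    and le: "\<And>M. crossing A (verts G - A) M \<Longrightarrow>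
      induced_matching (delete_edges G (edges_within G (verts G - A))) M \<Longrightarrow> card M \<le> k"
  shows "umim G A \<le> k"
proof -
  let ?H = "delete_edges G (edges_within G (verts G - A))"
  let ?M = "{M. crossing A (verts G - A) M \<and> induced_matching ?H M}"
  have "edges G \<subseteq> Pow (verts G)" using G by (auto simp: simple_graph_def)
  then have "finite (edges G)" using G by (auto simp: simple_graph_def intro: finite_subset)
  then have fin: "finite ?M"
    by (rule_tac finite_subset[of _ "Pow (edges G)"]) (auto simp: induced_matching_def matching_def)
  \<comment> \<open>Since no edge is empty, the empty matching is induced; the \<open>Max\<close> is
    thus over a nonempty set.\<close>
  have "e \<noteq> {}" if "e \<in> edges G" for e using G that by (auto simp: simple_graph_def)
  then have "{} \<in> ?M"
    by (auto simp: crossing_def induced_matching_def matching_def induced_subgraph_def edges_within_def)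
  then have "Max (card ` ?M) \<le> k" using fin le by (subst Max_le_iff) auto
  moreover have "card ` ?M = {card M |M. crossing A (verts G - A) M \<and> induced_matching ?H M}"
    by auto
  ultimately show ?thesis by (simp add: umim_def Let_def)
qed

text \<open>All edges of a crossing matching contain \<open>v\<close>, so they coincide.\<close>

lemma umim_singleton_le: "simple_graph G \<Longrightarrow> umim G {v} \<le> 1"
proof (rule umim_le)
  fix M assume cr: "crossing {v} (verts G - {v}) M"
    and "induced_matching (delete_edges G (edges_within G (verts G - {v}))) M"
  then have "\<forall>e\<in>M. \<forall>e'\<in>M. e \<noteq> e' \<longrightarrow> e \<inter> e' = {}" by (simp add: induced_matching_def matching_def)
  moreover have "v \<in> e" if "e \<in> M" for e using cr that by (auto simp: crossing_def)
  ultimately have "\<forall>e\<in>M. \<forall>e'\<in>M. e = e'" by blast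
  then show "card M \<le> 1" by (metis One_nat_def card.empty card_le_Suc0_iff_eq card.infinite zero_le)
qed

lemma alpha_ge:
  assumes "simple_graph G" "I \<subseteq> X" "independent G I"
  shows "card I \<le> alpha G X"
proof -
  have "{card I |I. I \<subseteq> X \<and> independent G I} \<subseteq> card ` Pow (verts G)"
    by (auto simp: independent_def)
  then have "finite {card I |I. I \<subseteq> X \<and> independent G I}"
    by (rule finite_subset) (use assms in \<open>simp add: simple_graph_def\<close>)
  then show ?thesis unfolding alpha_def using assms by (intro Max_ge) auto
qed

text \<open>Edges inside \<open>B\<close> survive the deletion, so the endpoints in \<open>B\<close>
  of an induced matching are independent; by the last assumption they lie in \<open>X\<close>. In
  the application \<open>B\<close> is the complement of a merged set and \<open>X\<close> a
  bag.\<close>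

lemma umim_le_alpha:
  assumes G: "simple_graph G" and B: "B \<subseteq> verts G"
    and X: "\<And>a b. {a, b} \<in> edges G \<Longrightarrow> a \<notin> B \<Longrightarrow> b \<in> B \<Longrightarrow> b \<in> X"
  shows "umim G B \<le> alpha G X"
proof (rule umim_le[OF G])
  let ?H = "delete_edges G (edges_within G (verts G - B))"
  fix M assume cr: "crossing B (verts G - B) M" and ind: "induced_matching ?H M"
  have "\<forall>e\<in>M. \<exists>b a. b \<in> B \<and> a \<notin> B \<and> e = {b, a}" using cr unfolding crossing_def by blast
  then obtain b a where ba: "\<And>e. e \<in> M \<Longrightarrow> b e \<in> B \<and> a e \<notin> B \<and> e = {b e, a e}" by metis
  have ME: "M \<subseteq> edges G" and disj: "\<And>e e'. e \<in> M \<Longrightarrow> e' \<in> M \<Longrightarrow> e \<noteq> e' \<Longrightarrow> e \<inter> e' = {}"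
    and full: "edges_within ?H (\<Union>M) = M"
    using ind by (auto simp: induced_matching_def matching_def induced_subgraph_def)
  have bin: "b e \<in> e" if "e \<in> M" for e using ba[OF that] by blast
  have inj: "inj_on b M"
  proof (rule inj_onI)
    fix e e' assume "e \<in> M" "e' \<in> M" "b e = b e'"
    then show "e = e'" using disj bin by (metis IntI empty_iff)
  qed
  have sub: "b ` M \<subseteq> X"
  proof
    fix x assume "x \<in> b ` M"
    then obtain e where e: "e \<in> M" "x = b e" by blast
    then have "{a e, b e} \<in> edges G" using ME ba[OF e(1)] by (metis insert_commute subsetD)
    then show "x \<in> X" using X ba e by blast
  qed
  have "{b e, b e'} \<notin> edges G" if e: "e \<in> M" "e' \<in> M" for e e'
  proof
    \<comment> \<open>Inducedness puts such an edge into \<open>M\<close>. It meets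
      \<open>e\<close>, hence equals \<open>e\<close>, whose other endpoint \<open>a e\<close> is
      outside \<open>B\<close>.\<close>
    assume E: "{b e, b e'} \<in> edges G"
    have "{b e, b e'} \<notin> edges_within G (verts G - B)" using ba[OF e(1)]
      by (auto simp: edges_within_def)
    then have "{b e, b e'} \<in> edges_within ?H (\<Union>M)"
      using E e bin by (auto simp: edges_within_def)
    then have "{b e, b e'} \<in> M" by (simp add: full)
    then have "{b e, b e'} = e" using disj[OF _ e(1)] bin[OF e(1)] by blast
    moreover have "a e \<in> e" using ba[OF e(1)] by blast
    ultimately have "a e \<in> {b e, b e'}" by (simp only:)
    moreover have "b e \<in> B" "b e' \<in> B" "a e \<notin> B" using ba e by blast+
    ultimately show False by auto
  qed
  then have "independent G (b ` M)"
    using ba B by (auto simp: independent_def)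
  then have "card (b ` M) \<le> alpha G X" using alpha_ge[OF G sub] by blast
  then show "card M \<le> alpha G X" using inj by (simp add: card_image)
qed

section \<open>From binary families to branch decompositions\<close>

lemma branch_width_le_of_decomposition:
  assumes "branch_decomposition V T \<delta>"
    and "\<And>x y. {x, y} \<in> edges T \<Longrightarrow> f (edge_side V T \<delta> x y) \<le> k"
  shows "branch_width V f \<le> enat k"
proof (cases "V = {}")
  case False
  have sub: "{f (edge_side V T \<delta> x y) | x y. {x, y} \<in> edges T} \<subseteq> {..k}" using assms(2) by auto
  then have "finite {f (edge_side V T \<delta> x y) | x y. {x, y} \<in> edges T}" by (rule finite_subset) simp
  then have "branch_decomposition_width V f T \<delta> \<le> k"
    unfolding branch_decomposition_width_def using sub by (subst Max_le_iff) auto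
  moreover have "branch_width V f \<le> enat (branch_decomposition_width V f T \<delta>)"
    using False assms(1) by (auto simp: branch_width_def intro!: Inf_lower)
  ultimately show ?thesis by (meson enat_ord_simps(1) order_trans)
qed (simp add: branch_width_def)

text \<open>The one-node tree has no edges. This covers graphs with one vertex, where nothing but
  \<open>w\<close> is left to merge.\<close>

lemma branch_width_singleton: "branch_width {w} f \<le> enat k"
proof (rule branch_width_le_of_decomposition)
  let ?T = "\<lparr>verts = {0 :: nat}, edges = {}\<rparr>"
  have "tree ?T" using tree_of_parent_function[of "{0 :: nat}" 0 id id] by simp
  then show "branch_decomposition {w} ?T (\<lambda>_. 0)"
    by (simp add: branch_decomposition_def leaves_def degree_def bij_betw_def)
qed simp

text \<open>The sets strictly containing \<open>Y\<close> meet in the nonempty \<open>Y\<close>, so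
  laminarity makes them a chain and one of least cardinality is the least. Adding \<open>V\<close>
  on top gives \<open>X\<close> a parent too.\<close>

lemma binary_family_parent:
  assumes F: "binary_family P X F" and V: "finite V" "X \<subset> V"
  shows "\<exists>par. \<forall>Y\<in>F. par Y \<in> insert V F \<and> Y \<subset> par Y \<and> (\<forall>Z\<in>insert V F. Y \<subset> Z \<longrightarrow> par Y \<subseteq> Z)"
proof -
  have "\<exists>Q. Q \<in> insert V F \<and> Y \<subset> Q \<and> (\<forall>Z\<in>insert V F. Y \<subset> Z \<longrightarrow> Q \<subseteq> Z)" if Y: "Y \<in> F" for Y
  proof -
    have sub: "Z \<subseteq> X" "Z \<noteq> {}" if "Z \<in> F" for Z using F that by (auto simp: binary_family_def)
    have "V \<in> insert V F \<and> Y \<subset> V" using sub[OF Y] V by blast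
    then have "\<exists>Q. (Q \<in> insert V F \<and> Y \<subset> Q) \<and>
        (\<forall>Z. Z \<in> insert V F \<and> Y \<subset> Z \<longrightarrow> card Q \<le> card Z)"
      by (rule ex_has_least_nat)
    then obtain Q where Q: "Q \<in> insert V F" "Y \<subset> Q"
      and min: "\<And>Z. Z \<in> insert V F \<and> Y \<subset> Z \<longrightarrow> card Q \<le> card Z"
      by (elim exE conjE) (erule that, assumption, erule spec)
    have "Q \<subseteq> Z" if Z: "Z \<in> insert V F" "Y \<subset> Z" for Z
    proof -
      have "Q \<subseteq> Z \<or> Z \<subseteq> Q \<or> Q \<inter> Z = {}"
      proof (cases "Q = V \<or> Z = V")
        case True
        then show ?thesis using sub V Q(1) Z(1) by blast
      next
        case False
        then show ?thesis using F Q(1) Z(1) by (auto simp: binary_family_def)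
      qed
      moreover have "Q \<inter> Z \<noteq> {}" using Q(2) Z(2) sub(2)[OF Y] by blast
      moreover have "Q = Z" if "Z \<subseteq> Q"
      proof (rule card_seteq[symmetric])
        have "Q \<subseteq> V" using Q(1) sub V(2) by blast
        then show "finite Q" using V(1) by (rule finite_subset)
        show "Z \<subseteq> Q" by fact
        show "card Q \<le> card Z" by (rule min[THEN mp, OF conjI[OF Z]])
      qed
      ultimately show ?thesis by blast
    qed
    then show ?thesis using Q by (intro exI[of _ Q] conjI ballI impI) simp_all
  qed
  then show ?thesis by (intro bchoice ballI)
qed

text \<open>The decomposition tree has the members of the family as nodes, each joined to the least
  member strictly containing it; the leaf of \<open>w\<close> serves as an additional root above \<open>X\<close>, so that
  no node of degree \<open>2\<close> arises.\<close>

lemma branch_width_le_of_binary_family: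
  assumes F: "binary_family (\<lambda>Y. f Y \<le> k) X F"
    and fin: "finite X" and w: "w \<notin> X"
    and sym: "\<And>Y. Y \<subseteq> insert w X \<Longrightarrow> f (insert w X - Y) = f Y"
  shows "branch_width (insert w X) f \<le> enat k"
proof -
  define V where "V = insert w X"
  define N where "N = insert V F"
  have finF: "finite F" and XF: "X \<in> F" and sub: "\<And>Y. Y \<in> F \<Longrightarrow> Y \<subseteq> X"
    and ne: "\<And>Y. Y \<in> F \<Longrightarrow> Y \<noteq> {}" and le: "\<And>Y. Y \<in> F \<Longrightarrow> f Y \<le> k"
    and cases_F: "\<And>Y. Y \<in> F \<Longrightarrow> (\<exists>v. Y = {v}) \<or> (\<exists>Y1\<in>F. \<exists>Y2\<in>F. Y = Y1 \<union> Y2 \<and> Y1 \<inter> Y2 = {} \<and>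
           (\<forall>Z\<in>F. Z \<subset> Y \<longrightarrow> Z \<subseteq> Y1 \<or> Z \<subseteq> Y2))"
    and singF: "\<And>v. v \<in> X \<Longrightarrow> {v} \<in> F"
    using F by (simp_all add: binary_family_def)
  have finV: "finite V" and XV: "X \<subset> V" using fin w by (auto simp: V_def)
  have VF: "V \<notin> F" using sub XV by blast
  have finN: "finite N" and VN: "V \<in> N" and FN: "F \<subseteq> N" using finF by (auto simp: N_def)
  have NV: "Y \<subseteq> V" if "Y \<in> N" for Y using that sub XV by (auto simp: N_def)
  obtain par where "\<forall>Y\<in>F. par Y \<in> N \<and> Y \<subset> par Y \<and> (\<forall>Z\<in>N. Y \<subset> Z \<longrightarrow> par Y \<subseteq> Z)"
    using binary_family_parent[OF F finV XV] by (auto simp: N_def)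
  then have parN: "\<And>Y. Y \<in> F \<Longrightarrow> par Y \<in> N" and par_sup: "\<And>Y. Y \<in> F \<Longrightarrow> Y \<subset> par Y"
    and par_min: "\<And>Y Z. Y \<in> F \<Longrightarrow> Z \<in> N \<Longrightarrow> Y \<subset> Z \<Longrightarrow> par Y \<subseteq> Z" by auto
  \<comment> \<open>Decomposition trees have natural numbers as nodes, so the members of
    \<open>N\<close> are numbered; \<open>S\<close> decodes a number.\<close>
  obtain num :: "'a set \<Rightarrow> nat" where num: "inj_on num N"
    using finite_imp_inj_to_nat_seg[OF finN] by blast
  have num_eq: "num Y = num Z \<longleftrightarrow> Y = Z" if "Y \<in> N" "Z \<in> N" for Y Z
    using num that by (auto dest: inj_onD)
  define S where "S = inv_into N num"
  have S: "S (num Y) = Y" if "Y \<in> N" for Y using num that by (simp add: S_def)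
  define par' where "par' = (\<lambda>n. num (par (S n)))"
  define W where "W = num ` N"
  define T where "T = \<lparr>verts = W, edges = (\<lambda>x. {x, par' x}) ` (W - {num V})\<rparr>"
  have WV: "W - {num V} = num ` F" using VF num_eq FN VN by (auto simp: W_def N_def)
  have par': "par' (num Y) = num (par Y)" if "Y \<in> F" for Y
    using that S FN by (auto simp: par'_def)
  have edges_T: "edges T = (\<lambda>Y. {num Y, num (par Y)}) ` F"
    by (simp add: T_def WV image_image par')
  have finW: "finite W" using finN by (simp add: W_def)
  \<comment> \<open>The cardinality of the represented set is the height required of a parent
    function.\<close>
  have up: "par' x \<in> W \<and> card (S x) < card (S (par' x))" if x: "x \<in> W - {num V}" for x
  proof -
    obtain Y where Y: "Y \<in> F" "x = num Y" using x WV by blast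
    have "finite (par Y)" using parN[OF Y(1)] NV finV finite_subset by blast
    then have "card Y < card (par Y)" using par_sup[OF Y(1)] by (rule psubset_card_mono)
    then show ?thesis using Y par' S parN FN by (auto simp: W_def)
  qed
  have tree: "tree T"
    unfolding T_def using finW up VN
    by (intro tree_of_parent_function[where h = "\<lambda>x. card (S x)"]) (auto simp: W_def)
  have deg: "degree T (num Y) = (if Y = V then 0 else 1) + card {Z \<in> F. par Z = Y}" if Y: "Y \<in> N"
    for Y
  proof -
    have "{x \<in> W - {num V}. par' x = num Y} = num ` {Z \<in> F. par Z = Y}"
      unfolding WV using par' num_eq parN Y by auto
    moreover have "inj_on num {Z \<in> F. par Z = Y}" by (rule inj_on_subset[OF num]) (use FN in auto)
    ultimately have "card {x \<in> W - {num V}. par' x = num Y} = card {Z \<in> F. par Z = Y}"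
      by (simp add: card_image)
    moreover have "num Y \<in> W" using Y by (simp add: W_def)
    ultimately show ?thesis
      using degree_parent_function[where h = "\<lambda>x. card (S x)", OF finW up] num_eq[OF Y VN]
      by (simp add: T_def)
  qed
  \<comment> \<open>The only child of \<open>V\<close> is \<open>X\<close>, which makes the root a
    leaf.\<close>
  have deg_V: "degree T (num V) = 1"
  proof -
    have "par Z \<subseteq> X" if "Z \<in> F" "Z \<noteq> X" for Z
      using that sub XF FN by (intro par_min) auto
    moreover have "par X = V" using parN[OF XF] par_sup[OF XF] sub by (auto simp: N_def)
    ultimately have "{Z \<in> F. par Z = V} = {X}" using XF XV by auto
    then show ?thesis using deg[OF VN] by simp
  qed
  have deg_sing: "degree T (num {v}) = 1" if v: "v \<in> X" for v
  proof -
    have "Z = {}" if "Z \<in> F" "par Z = {v}" for Z using par_sup[OF that(1)] that(2) by auto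
    then have "{Z \<in> F. par Z = {v}} = {}" using ne by auto
    moreover have "{v} \<noteq> V" using singF[OF v] VF by auto
    moreover have "{v} \<in> N" using singF[OF v] FN by blast
    ultimately show ?thesis using deg[of "{v}"] by (simp only: card.empty if_False)
  qed
  have deg_inner: "degree T (num Y) = 3" if Y: "Y \<in> F" "\<nexists>v. Y = {v}" for Y
  proof -
    have "\<exists>Y1\<in>F. \<exists>Y2\<in>F. Y = Y1 \<union> Y2 \<and> Y1 \<inter> Y2 = {} \<and>
        (\<forall>Z\<in>F. Z \<subset> Y \<longrightarrow> Z \<subseteq> Y1 \<or> Z \<subseteq> Y2)"
      using cases_F[OF Y(1)] Y(2) by argo
    then obtain Y1 Y2 where Y12: "Y1 \<in> F" "Y2 \<in> F" "Y = Y1 \<union> Y2" "Y1 \<inter> Y2 = {}"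
      and all: "\<forall>Z\<in>F. Z \<subset> Y \<longrightarrow> Z \<subseteq> Y1 \<or> Z \<subseteq> Y2"
      by (elim bexE conjE)
    have max: "Z \<subseteq> Y1 \<or> Z \<subseteq> Y2" if "Z \<in> F" "Z \<subset> Y" for Z using all that by simp
    have nonempty: "Y1 \<noteq> {}" "Y2 \<noteq> {}" using ne Y12 by auto
    \<comment> \<open>A parent of \<open>A\<close> strictly inside \<open>Y\<close> would lie in
      \<open>A\<close> or in \<open>B\<close>, yet it strictly contains the nonempty
      \<open>A\<close>.\<close>
    have child: "par A = Y" if A: "A \<in> F" "B \<in> F" "Y = A \<union> B" "A \<inter> B = {}"
      and mx: "\<And>Z. Z \<in> F \<Longrightarrow> Z \<subset> Y \<Longrightarrow> Z \<subseteq> A \<or> Z \<subseteq> B" for A B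
    proof (rule ccontr)
      assume "par A \<noteq> Y"
      moreover have "A \<subset> Y" using A(3,4) ne[OF A(2)] by blast
      ultimately have *: "par A \<subset> Y" using par_min[OF A(1), of Y] Y(1) FN by blast
      then have "par A \<in> F" using parN[OF A(1)] NV[of Y] Y(1) FN by (auto simp: N_def)
      then have "par A \<subseteq> A \<or> par A \<subseteq> B" using * by (rule mx)
      then show False using par_sup[OF A(1)] ne[OF A(1)] A(4) by blast
    qed
    have "Z = Y1 \<or> Z = Y2" if Z: "Z \<in> F" "par Z = Y" for Z
    proof (rule ccontr)
      assume n: "\<not> (Z = Y1 \<or> Z = Y2)"
      have "Z \<subset> Y" using par_sup[OF Z(1)] Z(2) by simp
      from max[OF Z(1) this] have "Z \<subset> Y1 \<or> Z \<subset> Y2" using n by blast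
      then have "par Z \<subseteq> Y1 \<or> par Z \<subseteq> Y2"
        using par_min[OF Z(1), of Y1] par_min[OF Z(1), of Y2] Y12(1,2) FN by blast
      then show False using Z Y12 nonempty by blast
    qed
    moreover have "par Y1 = Y" using Y12 max by (rule child)
    moreover have "par Y2 = Y"
    proof (rule child)
      show "Z \<subseteq> Y2 \<or> Z \<subseteq> Y1" if "Z \<in> F" "Z \<subset> Y" for Z using max[OF that]
        by (rule disj_commute[THEN iffD1])
    qed (use Y12 in auto)
    ultimately have "{Z \<in> F. par Z = Y} = {Y1, Y2}" using Y12(1,2) by auto
    moreover have "Y1 \<noteq> Y2" using Y12 nonempty by auto
    ultimately have "card {Z \<in> F. par Z = Y} = 2" by simp
    moreover have "Y \<in> N" "Y \<noteq> V" using Y(1) FN VF by auto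
    ultimately show ?thesis using deg[of Y] by simp
  qed
  \<comment> \<open>The leaves are the singletons from \<open>X\<close> and the root
    \<open>V\<close>, which stands for \<open>w\<close>.\<close>
  define node where "node = (\<lambda>v. if v = w then V else {v})"
  define \<delta> where "\<delta> = (\<lambda>v. num (node v))"
  have node_N: "node v \<in> N" if "v \<in> V" for v
    using that singF FN VN by (auto simp: node_def V_def)
  have node_sub: "node v \<subseteq> Y \<longleftrightarrow> v \<in> Y" if "Y \<in> F" for v Y
    using sub[OF that] w by (auto simp: node_def V_def)
  have leaf_iff: "degree T (num Y) \<le> 1 \<longleftrightarrow> Y \<in> node ` V" if "Y \<in> N" for Y
  proof (cases "Y = V")
    case True
    then show ?thesis using deg_V by (auto simp: node_def V_def)
  next
    case False
    then have YF: "Y \<in> F" using that by (simp add: N_def)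
    show ?thesis
    proof (cases "\<exists>v. Y = {v}")
      case True
      then obtain v where v: "Y = {v}" by blast
      then have "v \<in> X" using sub[OF YF] by simp
      then show ?thesis using deg_sing v w by (auto simp: node_def V_def image_iff)
    next
      case no: False
      then show ?thesis using deg_inner[OF YF no] False by (auto simp: node_def)
    qed
  qed
  have leaves_T: "leaves T = num ` node ` V"
    using leaf_iff node_N by (auto simp: leaves_def T_def W_def)
  have inj_node: "inj_on node V"
    using XV VF singF by (auto simp: inj_on_def node_def V_def split: if_splits)
  have "bij_betw \<delta> V (leaves T)"
    unfolding leaves_T \<delta>_def bij_betw_def
    using inj_node node_N by (auto simp: inj_on_def num_eq image_image)
  moreover have "\<forall>t\<in>verts T - leaves T. degree T t = 3"
  proof
    fix t assume t: "t \<in> verts T - leaves T"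
    then obtain Y where Y: "Y \<in> N" "t = num Y" by (auto simp: T_def W_def)
    then have n: "Y \<notin> node ` V" using t leaves_T by auto
    then have "Y \<in> F" using Y by (auto simp: N_def node_def V_def)
    moreover have "\<nexists>v. Y = {v}"
    proof
      assume "\<exists>v. Y = {v}"
      then obtain v where v: "Y = {v}" by blast
      then have "v \<in> X" using sub[OF \<open>Y \<in> F\<close>] by simp
      then have "Y = node v" "v \<in> V" using v w by (auto simp: node_def V_def)
      then show False using n by blast
    qed
    ultimately show "degree T t = 3" using deg_inner Y by simp
  qed
  ultimately have bd: "branch_decomposition V T \<delta>" using tree
    by (simp add: branch_decomposition_def)
  have sides: "edge_side V T \<delta> (num Y) (num (par Y)) = Y"
      "edge_side V T \<delta> (num (par Y)) (num Y) = V - Y" if Y: "Y \<in> F" for Y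
  proof -
    have YN: "Y \<in> N" using Y FN by blast
    have par_le: "par Z \<subseteq> Y" if "Z \<in> F" "Z \<subseteq> Y" "Z \<noteq> Y" for Z
      using par_min[OF that(1) YN] that(2,3) by blast
    have par_ge: "Z \<subseteq> Y" if "Z \<in> F" "par Z \<subseteq> Y" for Z
      using par_sup[OF that(1)] that(2) by blast
    \<comment> \<open>Deleting this edge should separate the members contained in \<open>Y\<close>
      from all others.\<close>
    define H where "H = delete_edges T {{num Y, num (par Y)}}"
    have step: "reachable H (num Z) (num (par Z))" if Z: "Z \<in> F" "Z \<noteq> Y" for Z
    proof (rule reachable_edge)
      have N: "Z \<in> N" "par Z \<in> N" "par Y \<in> N" using Z(1) Y parN FN by auto
      have "\<not> (Z = par Y \<and> par Z = Y)" using par_sup[OF Z(1)] par_sup[OF Y] by auto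
      then have "{num Z, num (par Z)} \<noteq> {num Y, num (par Y)}"
        using num_eq[OF N(1) YN] num_eq[OF N(1,3)] num_eq[OF N(2) YN] Z(2)
        unfolding doubleton_eq_iff by argo
      then show "{num Z, num (par Z)} \<in> edges H" using Z by (auto simp: H_def edges_T)
    qed
    \<comment> \<open>Below \<open>Y\<close>, climbing along parents reaches \<open>Y\<close> before
      the deleted edge.\<close>
    have up_Y: "reachable H (num Z) (num Y)" if "Z \<in> F" "Z \<subseteq> Y" for Z
      using that
    proof (induction "card (Y - Z)" arbitrary: Z rule: less_induct)
      case less
      show ?case
      proof (cases "Z = Y")
        case False
        then have p: "par Z \<subseteq> Y" using par_le less.prems by blast
        then have "par Z \<in> F" using parN[OF less.prems(1)] sub[OF Y] XV by (auto simp: N_def)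
        moreover have "card (Y - par Z) < card (Y - Z)"
        proof (rule psubset_card_mono)
          show "finite (Y - Z)" using sub[OF Y] fin finite_subset by blast
          show "Y - par Z \<subset> Y - Z" using par_sup[OF less.prems(1)] p by blast
        qed
        ultimately have "reachable H (num (par Z)) (num Y)" using p by (intro less.hyps)
        then show ?thesis using step[OF less.prems(1) False] by (rule reachable_trans[rotated])
      qed (simp add: reachable_refl)
    qed
    \<comment> \<open>From a member not inside \<open>Y\<close>, climbing never passes through
      \<open>Y\<close> and ends at the root.\<close>
    have up_V: "reachable H (num Z) (num V)" if "Z \<in> N" "\<not> Z \<subseteq> Y" for Z
      using that
    proof (induction "card (V - Z)" arbitrary: Z rule: less_induct)
      case less
      show ?case
      proof (cases "Z = V")
        case False
        then have Z: "Z \<in> F" using less.prems by (simp add: N_def)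
        have "card (V - par Z) < card (V - Z)"
        proof (rule psubset_card_mono)
          show "finite (V - Z)" using finV by blast
          show "V - par Z \<subset> V - Z" using par_sup[OF Z] NV[OF parN[OF Z]] by blast
        qed
        moreover have "\<not> par Z \<subseteq> Y" using less.prems(2) par_ge[OF Z] by blast
        ultimately have "reachable H (num (par Z)) (num V)" using parN[OF Z] by (intro less.hyps)
        moreover have "reachable H (num Z) (num (par Z))" using step[OF Z] less.prems(2) by blast
        ultimately show ?thesis by (rule reachable_trans[rotated])
      qed (simp add: reachable_refl)
    qed
    \<comment> \<open>For a member other than \<open>Y\<close>, lying inside \<open>Y\<close> is
      equivalent for it and its parent, so no edge of \<open>H\<close> leaves the members inside
      \<open>Y\<close>.\<close>
    have down: "Z \<subseteq> Y" if reach: "reachable H (num Y) (num Z)" and Z: "Z \<in> N" for Z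
    proof -
      have "num Z \<in> num ` {Z \<in> N. Z \<subseteq> Y}"
        using reach
      proof (rule reachable_closed)
        show "num Y \<in> num ` {Z \<in> N. Z \<subseteq> Y}" using Y FN by auto
      next
        fix x y assume e: "{x, y} \<in> edges H" and x: "x \<in> num ` {Z \<in> N. Z \<subseteq> Y}"
        then obtain A where A: "A \<in> N" "A \<subseteq> Y" "x = num A" by blast
        from e obtain B where B: "B \<in> F" "{x, y} = {num B, num (par B)}" "B \<noteq> Y"
          by (auto simp: H_def edges_T)
        have BN: "B \<in> N" "par B \<in> N" using B(1) parN FN by auto
        have "B \<subseteq> Y \<and> par B \<subseteq> Y"
          using B(2,3) A num_eq[OF A(1)] BN par_le[OF B(1)] par_ge[OF B(1)]
          by (auto simp: doubleton_eq_iff)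
        then show "y \<in> num ` {Z \<in> N. Z \<subseteq> Y}"
          using B(2) BN by (auto simp: doubleton_eq_iff)
      qed
      then show ?thesis using num_eq Z by auto
    qed
    have not_par: "\<not> par Y \<subseteq> Y" using par_sup[OF Y] by blast
    have in_iff: "reachable H (num Y) (\<delta> v) \<longleftrightarrow> v \<in> Y" if v: "v \<in> V" for v
    proof
      assume "reachable H (num Y) (\<delta> v)"
      then show "v \<in> Y" using down[of "node v"] node_N[OF v] node_sub[OF Y] by (simp add: \<delta>_def)
    next
      assume vY: "v \<in> Y"
      then have "node v = {v}" "{v} \<in> F" using sub[OF Y] w singF by (auto simp: node_def)
      then show "reachable H (num Y) (\<delta> v)" using up_Y[of "{v}"] vY
        by (auto simp: \<delta>_def intro: reachable_sym)
    qed
    have out_iff: "reachable H (num (par Y)) (\<delta> v) \<longleftrightarrow> v \<notin> Y" if v: "v \<in> V" for v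
    proof
      assume r: "reachable H (num (par Y)) (\<delta> v)"
      show "v \<notin> Y"
      proof
        assume "v \<in> Y"
        then have "reachable H (num Y) (\<delta> v)" using in_iff[OF v] by simp
        then have "reachable H (num Y) (num (par Y))" using reachable_sym[OF r]
          by (rule reachable_trans)
        then show False using down parN[OF Y] not_par by blast
      qed
    next
      assume "v \<notin> Y"
      then have "reachable H (\<delta> v) (num V)" unfolding \<delta>_def
        using node_N[OF v] node_sub[OF Y] by (intro up_V) auto
      moreover have "reachable H (num (par Y)) (num V)" using up_V parN[OF Y] not_par by blast
      ultimately show "reachable H (num (par Y)) (\<delta> v)"
        by (rule reachable_trans[OF _ reachable_sym, rotated])
    qed
    show "edge_side V T \<delta> (num Y) (num (par Y)) = Y"
      using in_iff sub[OF Y] XV by (auto simp: edge_side_def H_def)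
    show "edge_side V T \<delta> (num (par Y)) (num Y) = V - Y"
      using out_iff by (auto simp: edge_side_def H_def insert_commute)
  qed
  have "branch_width V f \<le> enat k"
  proof (rule branch_width_le_of_decomposition[OF bd])
    fix x y assume "{x, y} \<in> edges T"
    then obtain Y where Y: "Y \<in> F" "{x, y} = {num Y, num (par Y)}" by (auto simp: edges_T)
    have "f (V - Y) = f Y" using sym[of Y] sub[OF Y(1)] XV by (auto simp: V_def)
    then show "f (edge_side V T \<delta> x y) \<le> k"
      using Y sides[OF Y(1)] le[OF Y(1)] by (auto simp: doubleton_eq_iff)
  qed
  then show ?thesis by (simp add: V_def)
qed

theorem theorem2:
  fixes G :: "'a sgraph" and k :: nat
  assumes "simple_graph G"
    and "tree_independence_number G = enat k"
  shows "omim_width G \<le> enat k"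
proof (cases "verts G = {}")
  case True
  then show ?thesis by (simp add: omim_width_def branch_width_def)
next
  case False
  then obtain w where w: "w \<in> verts G" by blast
  note G = assms(1)
  let ?D = "{enat (independence_width G T bag) | T bag. tree_decomposition G T bag}"
  have "Inf ?D = enat k" using assms(2) by (simp only: tree_independence_number_def)
  \<comment> \<open>The infimum of the empty set would be infinite; a nonempty infimum in
    \<open>enat\<close> is attained, which yields an actual decomposition.\<close>
  then have "?D \<noteq> {}" by (metis Inf_enat_def enat.distinct(1))
  then have "Inf ?D \<in> ?D" unfolding Inf_enat_def using LeastI
    by (metis (mono_tags, lifting) ex_in_conv)
  then obtain T bag where td: "tree_decomposition G T bag" and k: "independence_width G T bag = k"
    using assms(2) by (auto simp: tree_independence_number_def)
  have "finite (verts T)" using tree_decomposition_tree[OF td]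
    by (simp add: tree_def simple_graph_def)
  then have alpha_le: "alpha G (bag c) \<le> k" if "c \<in> verts T" for c
    using that k by (auto simp: independence_width_def intro!: Max_ge)
  obtain r where r: "r \<in> verts T" "w \<in> bag r"
    using bag_nodes_nonempty[OF td w] by (auto simp: bag_nodes_def)
  have "independent G {w}" using G w by (auto simp: independent_def simple_graph_def)
  \<comment> \<open>A vertex exists, so \<open>k\<close> is at least 1, as the bound 1 on the cuts
    of singletons requires.\<close>
  then have "1 \<le> alpha G (bag r)" using alpha_ge[OF G, of "{w}"] r by auto
  then have k1: "1 \<le> k" using alpha_le[OF r(1)] by simp
  have "hierarchical (\<lambda>A. omim G A \<le> k) (verts G - {w})"
  proof (rule hierarchical_vertices_minus[OF G td _ _ r])
    show "omim G {v} \<le> k" for v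
      using umim_singleton_le[OF G, of v] k1 by (simp add: omim_def)
  next
    fix A c assume c: "c \<in> verts T" and A: "A \<subseteq> verts G"
      and sep: "\<And>a b. {a, b} \<in> edges G \<Longrightarrow> a \<in> A \<Longrightarrow> b \<notin> A \<Longrightarrow> b \<in> bag c"
    have "umim G (verts G - A) \<le> alpha G (bag c)"
      \<comment> \<open>An endpoint of an edge outside the complement of \<open>A\<close> lies in
        \<open>A\<close>, so \<open>sep\<close> places the other endpoint in the bag.\<close>
      using sep simple_graph_edge[OF G] by (intro umim_le_alpha[OF G]) auto
    then show "omim G A \<le> k" using alpha_le[OF c] by (simp add: omim_def)
  qed
  then consider "verts G = {w}" |
    F where "binary_family (\<lambda>A. omim G A \<le> k) (verts G - {w}) F"
    using w by (auto simp: hierarchical_def)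
  then show ?thesis
  proof cases
    case 1
    then show ?thesis by (simp add: omim_width_def branch_width_singleton)
  next
    case 2
    have V: "insert w (verts G - {w}) = verts G" using w by auto
    show ?thesis
      using branch_width_le_of_binary_family[OF 2, of w, unfolded V] omim_symmetric[of _ G] G
      by (simp add: omim_width_def simple_graph_def)
  qed
qed

end
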